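(* Let $n\ge 3$, let $J_n\in\mathcal{J}_n$ with parameters $c_1,\dots,c_{n-1}\in\mathbb{R}$, $b_1,\dots,b_n\in\mathbb{C}\setminus\{0\}$, $a_n\in\mathbb{C}$, let $J_{n-1}$ be its leading principal $(n-1)\times(n-1)$ submatrix, and let $\beta=b_1b_2\cdots b_n$. Suppose that $\beta$ is nonreal. (1) If $a_n\in\mathbb{R}$, then all eigenvalues $\lambda_1<\dots<\lambda_n$ of $J_n$ are real and simple, all eigenvalues $\mu_1<\dots<\mu_{n-1}$ of $J_{n-1}$ are real and simple, and they strictly interlace: $\lambda_1<\mu_1<\lambda_2<\mu_2<\dots<\mu_{n-1}<\lambda_n$. (2) If $a_n\in\mathbb{C}\setminus\mathbb{R}$, then all eigenvalues of $J_n$ lie in the open upper half-plane if $\operatorname{Im}a_n>0$, and in the open lower half-plane if $\operatorname{Im}a_n<0$. (3) For every complex (real or nonreal) $a_n$, the characteristic polynomial $\chi_n(\lambda)=\det(\lambda I_n-J_n)$ takes real values at the eigenvalues $\mu_1<\dots<\mu_{n-1}$ of $J_{n-1}$ and satisfies $$(-1)^{n-k}\chi_n(\mu_k)>0,\qquad k=1,\dots,n-1.$$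
   Context: For $n\ge 3$, $\mathcal{J}_n$ is the class of complex $n\times n$ matrices $$J_n=\begin{pmatrix} c_1 & b_1 & 0 &\dots& 0 & \overline{b}_n\\ \overline{b}_1 & c_2 & b_2 &\dots& 0 & 0\\ 0 & \overline{b}_2 & c_3 &\dots& 0 & 0\\ \vdots&\vdots&\vdots&\ddots&\vdots&\vdots\\ 0&0&0&\dots&c_{n-1}&b_{n-1}\\ b_n&0&0&\dots&\overline{b}_{n-1}&a_n \end{pmatrix},$$ i.e. the diagonal entries are $c_1,\dots,c_{n-1},a_n$; the $(k,k+1)$ entry is $b_k$ and the $(k+1,k)$ entry is $\overline{b}_k$ for $k=1,\dots,n-1$; the $(1,n)$ entry is $\overline{b}_n$ and the $(n,1)$ entry is $b_n$; all other entries are $0$. Here $c_1,\dots,c_{n-1}\in\mathbb{R}$, $b_1,\dots,b_n\in\mathbb{C}\setminus\{0\}$, $a_n\in\mathbb{C}$. The submatrix $J_{n-1}$ is self-adjoint with real simple eigenvalues, numbered in increasing order $\mu_1<\dots<\mu_{n-1}$. *)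

theory Defs
  imports
    "Jordan_Normal_Form.Spectral_Radius"
    "Jordan_Normal_Form.DL_Submatrix"
begin

text \<open>
  The parameters \<open>c 1, \<dots>, c (n - 1)\<close> and \<open>b 1, \<dots>, b n\<close> are indexed from 1, while the rows and
  columns of a matrix are indexed from 0. For \<open>n \<ge> 3\<close> the cases below do not overlap, so their
  order is irrelevant.
\<close>

definition periodic_jacobi_mat ::
    "nat \<Rightarrow> (nat \<Rightarrow> real) \<Rightarrow> (nat \<Rightarrow> complex) \<Rightarrow> complex \<Rightarrow> complex mat" where
  "periodic_jacobi_mat n c b a = mat n n (\<lambda>(i, j).
     if i = j then (if i = n - 1 then a else complex_of_real (c (i + 1)))
     else if j = i + 1 then b (i + 1)
     else if i = j + 1 then cnj (b (j + 1))
     else if i = 0 \<and> j = n - 1 then cnj (b n)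
     else if i = n - 1 \<and> j = 0 then b n
     else 0)"

text \<open>
  All eigenvalues of \<open>A\<close> are real and simple (as roots of the characteristic polynomial), and
  they are \<open>e 1 < \<dots> < e m\<close>.
\<close>

definition real_simple_eigenvalues :: "complex mat \<Rightarrow> nat \<Rightarrow> (nat \<Rightarrow> real) \<Rightarrow> bool" where
  "real_simple_eigenvalues A m e \<longleftrightarrow>
     strict_mono_on {1..m} e \<and>
     spectrum A = (\<lambda>k. complex_of_real (e k)) ` {1..m} \<and>
     (\<forall>k\<in>{1..m}. Polynomial.order (complex_of_real (e k)) (char_poly A) = 1)"

end

theory Submission
  imports Defs
begin

text \<open>
  Write \<open>n = m + 1\<close>, let \<open>P\<close> be the characteristic polynomial of the leading submatrix \<open>J'\<close>, and let
  \<open>\<beta> = b 1 * \<dots> * b n\<close>. Expanding the determinant (lemma \<open>char_poly_periodic_jacobi\<close>) shows that the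
  characteristic polynomial of \<open>J\<close> is \<open>\<chi> = (\<lambda> - a) * P - R\<close>, where
  \<open>R = \<bar>b m\<bar>\<^sup>2 * P\<^sub>1 + \<bar>b n\<bar>\<^sup>2 * P\<^sub>2 + 2 * Re \<beta>\<close> is a real polynomial and \<open>P\<^sub>1\<close>, \<open>P\<^sub>2\<close> are the
  characteristic polynomials of \<open>J'\<close> with its last, respectively its first, row and column deleted.

  At an eigenvalue \<open>\<mu> k\<close> of \<open>J'\<close> the parameter \<open>a\<close> drops out and \<open>\<chi> = - R\<close> is real. The identity
  \<open>continuant_identity\<close> for tridiagonal minors says that there the first two summands of \<open>R\<close> have
  product \<open>\<bar>\<beta>\<bar>\<^sup>2\<close>. They therefore have the same sign, and their sum has modulus at least \<open>2 * \<bar>\<beta>\<bar>\<close>, which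
  exceeds \<open>2 * \<bar>Re \<beta>\<bar>\<close> because \<open>\<beta>\<close> is nonreal. So \<open>R\<close> has the sign of \<open>P\<^sub>1\<close> at \<open>\<mu> k\<close>
  (lemma \<open>root_discriminant_same_sign\<close>). By Sturm's argument (lemma \<open>jacobi_poly_real_rooted\<close>) that
  sign is \<open>(- 1) ^ (m - k)\<close>, which is the third claim.

  If \<open>a\<close> is real, then \<open>\<chi>\<close> is a real monic polynomial of degree \<open>n\<close> with alternating signs at the
  \<open>\<mu> k\<close>, and the intermediate value theorem (lemma \<open>interlacing_roots\<close>) gives \<open>n\<close> strictly
  interlacing roots. If \<open>a\<close> is nonreal, then \<open>J\<close> differs from a Hermitian matrix only in the
  imaginary part of its last diagonal entry. Comparing imaginary parts in the quadratic form of an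
  eigenvector shows that every eigenvalue has an imaginary part of the same sign as \<open>Im a\<close>, as long as
  the last coordinate of the eigenvector is nonzero (lemma \<open>sgn_Im_eigenvalue\<close>). If that coordinate
  vanished, the eigenvalue would be some \<open>\<mu> k\<close>, which the third claim excludes.
\<close>

section \<open>Continuants\<close>

text \<open>
  The three-term recurrence satisfied by the leading principal minors of a tridiagonal matrix with
  diagonal \<open>d\<close>, where \<open>w i\<close> is the product of the two off-diagonal entries in rows \<open>i\<close> and \<open>i + 1\<close>.
  Over a polynomial ring it produces the characteristic polynomials.
\<close>

fun continuant :: "(nat \<Rightarrow> 'a) \<Rightarrow> (nat \<Rightarrow> 'a) \<Rightarrow> nat \<Rightarrow> 'a :: comm_ring_1" where
  "continuant d w 0 = 1"
| "continuant d w (Suc 0) = d 0"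
| "continuant d w (Suc (Suc k)) =
     d (Suc k) * continuant d w (Suc k) - w k * continuant d w k"

text \<open>
  Deleting the first row and column of a tridiagonal matrix gives a second solution of the same
  recurrence, with a shifted index. The difference below is the Casoratian of the two solutions, so
  each step multiplies it by the single factor \<open>w (Suc k)\<close>. At a zero of the second continuant it
  determines the product of two minors.
\<close>

lemma continuant_identity:
  fixes d w :: "nat \<Rightarrow> 'a :: comm_ring_1"
  defines "S \<equiv> continuant (\<lambda>i. d (Suc i)) (\<lambda>i. w (Suc i))"
  shows "continuant d w (Suc k) * S (Suc k) - continuant d w (Suc (Suc k)) * S k = (\<Prod>i\<le>k. w i)"
proof (induction k)
  case 0
  show ?case by (simp add: S_def algebra_simps)
next
  case (Suc k)
  let ?P = "continuant d w"
  have "?P (Suc (Suc k)) * S (Suc (Suc k)) - ?P (Suc (Suc (Suc k))) * S (Suc k) =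
      w (Suc k) * (?P (Suc k) * S (Suc k) - ?P (Suc (Suc k)) * S k)"
    unfolding continuant.simps(3)[of d w "Suc k"]
    by (simp add: S_def algebra_simps)
  thus ?case by (simp only: Suc) (simp add: mult.commute)
qed

lemma (in comm_ring_hom) hom_continuant:
  "hom (continuant d w k) = continuant (\<lambda>i. hom (d i)) (\<lambda>i. hom (w i)) k"
  by (induction k rule: induct_nat_012) (simp_all add: hom_distribs)

section \<open>Determinants of tridiagonal and cyclic tridiagonal matrices\<close>

definition tridiag_mat :: "(nat \<Rightarrow> 'a) \<Rightarrow> (nat \<Rightarrow> 'a) \<Rightarrow> (nat \<Rightarrow> 'a) \<Rightarrow> nat \<Rightarrow> 'a :: comm_ring_1 mat" where
  "tridiag_mat d u l k = mat k k (\<lambda>(i, j).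
     if i = j then d i else if j = Suc i then u i else if i = Suc j then l j else 0)"

lemma tridiag_mat_carrier [simp]: "tridiag_mat d u l k \<in> carrier_mat k k"
  by (simp add: tridiag_mat_def)

lemma sum_two_terms:
  fixes f :: "nat \<Rightarrow> 'a :: comm_monoid_add"
  assumes "r < k" "s < k" "r \<noteq> s" "\<And>i. i < k \<Longrightarrow> i \<noteq> r \<Longrightarrow> i \<noteq> s \<Longrightarrow> f i = 0"
  shows "(\<Sum>i<k. f i) = f r + f s"
proof -
  have "(\<Sum>i<k. f i) = (\<Sum>i\<in>{r, s}. f i)"
    by (rule sum.mono_neutral_right) (use assms in auto)
  thus ?thesis using assms(3) by simp
qed

text \<open>
  Expanding along the last row leaves two minors. The off-diagonal one has a single nonzero entry
  in its last column, and this yields the recurrence.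
\<close>

lemma det_tridiag_mat:
  "det (tridiag_mat d u l k) = continuant d (\<lambda>i. u i * l i) k"
proof (induction k rule: induct_nat_012)
  case 0
  show ?case by (simp add: tridiag_mat_def)
next
  case 1
  show ?case by (simp add: tridiag_mat_def det_single)
next
  case (ge2 k)
  let ?A = "tridiag_mat d u l (Suc (Suc k))"
  let ?B = "mat_delete ?A (Suc k) k"
  have del1: "mat_delete ?A (Suc k) (Suc k) = tridiag_mat d u l (Suc k)"
    by (rule eq_matI) (auto simp: mat_delete_def tridiag_mat_def)
  have del2: "mat_delete ?B k k = tridiag_mat d u l k"
    by (rule eq_matI) (auto simp: mat_delete_def tridiag_mat_def)
  have B: "?B \<in> carrier_mat (Suc k) (Suc k)"
    by (simp add: mat_delete_def tridiag_mat_def)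
  have "det ?B = (\<Sum>i<Suc k. ?B $$ (i, k) * cofactor ?B i k)"
    by (rule laplace_expansion_column[OF B]) simp
  also have "\<dots> = (\<Sum>i<k. ?B $$ (i, k) * cofactor ?B i k) + ?B $$ (k, k) * cofactor ?B k k"
    by simp
  also have "(\<Sum>i<k. ?B $$ (i, k) * cofactor ?B i k) = 0"
    by (rule sum.neutral) (auto simp: mat_delete_def tridiag_mat_def)
  also have "?B $$ (k, k) = u k"
    by (simp add: mat_delete_def tridiag_mat_def)
  finally have detB: "det ?B = u k * det (tridiag_mat d u l k)"
    by (simp add: cofactor_def del2 flip: mult_2)
  have "det ?A = (\<Sum>j<Suc (Suc k). ?A $$ (Suc k, j) * cofactor ?A (Suc k) j)"
    by (rule laplace_expansion_row) auto
  also have "\<dots> = ?A $$ (Suc k, k) * cofactor ?A (Suc k) k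
      + ?A $$ (Suc k, Suc k) * cofactor ?A (Suc k) (Suc k)"
    by (rule sum_two_terms) (auto simp: tridiag_mat_def)
  also have "\<dots> = d (Suc k) * det (tridiag_mat d u l (Suc k)) - l k * det ?B"
    by (simp add: cofactor_def del1 flip: mult_2) (simp add: tridiag_mat_def)
  finally show ?case
    by (simp add: detB ge2)
qed

text \<open>
  The last diagonal entry \<open>e\<close> is a parameter of its own: in a periodic Jacobi matrix it is the only
  one that may be nonreal, and it does not occur in the continuants of \<open>d\<close> in the determinant.
\<close>

definition cyclic_mat ::
    "(nat \<Rightarrow> 'a) \<Rightarrow> 'a \<Rightarrow> (nat \<Rightarrow> 'a) \<Rightarrow> (nat \<Rightarrow> 'a) \<Rightarrow> 'a \<Rightarrow> 'a \<Rightarrow> nat \<Rightarrow> 'a :: comm_ring_1 mat" where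
  "cyclic_mat d e u l p q m = mat (Suc m) (Suc m) (\<lambda>(i, j).
     if i = j then (if i = m then e else d i)
     else if j = Suc i then u i else if i = Suc j then l j
     else if i = 0 \<and> j = m then p else if i = m \<and> j = 0 then q else 0)"

text \<open>
  In the Leibniz expansion, a permutation that contributes either is a product of disjoint
  transpositions of cyclic neighbours or is one of the two full cycles. Products of transpositions
  that fix the last index, exchange it with its predecessor, or exchange it with the first index
  give the three continuants; the two full cycles give the products of the \<open>u i\<close> and of the \<open>l i\<close>. In the
  proof the same terms come from expanding along the last row and then expanding the two
  off-diagonal minors \<open>?M\<close> and \<open>?N\<close> once more, after which only tridiagonal and triangular matrices
  remain.
\<close>

lemma det_cyclic_mat:
  fixes d u l :: "nat \<Rightarrow> 'a :: idom"
  assumes "m \<ge> 2"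
  shows "det (cyclic_mat d e u l p q m) =
    e * continuant d (\<lambda>i. u i * l i) m
    - u (m - 1) * l (m - 1) * continuant d (\<lambda>i. u i * l i) (m - 1)
    - p * q * continuant (\<lambda>i. d (Suc i)) (\<lambda>i. u (Suc i) * l (Suc i)) (m - 1)
    + (- 1) ^ m * (q * (\<Prod>i<m. u i) + p * (\<Prod>i<m. l i))"
proof -
  obtain k where m: "m = Suc (Suc k)"
    using assms by (metis add_2_eq_Suc le_Suc_ex)
  let ?C = "cyclic_mat d e u l p q m"
  let ?M = "mat_delete ?C m 0"
  let ?N = "mat_delete ?C m (Suc k)"
  have carrier: "?C \<in> carrier_mat (Suc m) (Suc m)" "?M \<in> carrier_mat m m" "?N \<in> carrier_mat m m"
    by (simp_all add: mat_delete_def cyclic_mat_def)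

  have M1: "mat_delete ?M 0 (Suc k) =
      tridiag_mat (\<lambda>i. d (Suc i)) (\<lambda>i. u (Suc i)) (\<lambda>i. l (Suc i)) (Suc k)"
    by (rule eq_matI) (auto simp: mat_delete_def tridiag_mat_def cyclic_mat_def m)
  have "det (mat_delete ?M 0 0) = (\<Prod>i<Suc k. mat_delete ?M 0 0 $$ (i, i))"
  proof -
    have "det (mat_delete ?M 0 0) = prod_list (diag_mat (mat_delete ?M 0 0))"
      by (rule det_lower_triangular[where n = "Suc k"])
        (auto simp: mat_delete_def cyclic_mat_def m)
    thus ?thesis
      by (simp add: prod_list_diag_prod atLeast0LessThan mat_delete_def cyclic_mat_def m)
  qed
  also have "\<dots> = (\<Prod>i<Suc k. u (Suc i))"
    by (rule prod.cong) (auto simp: mat_delete_def cyclic_mat_def m)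
  finally have M0: "det (mat_delete ?M 0 0) = (\<Prod>i<Suc k. u (Suc i))" .
  have "det ?M = (\<Sum>j<m. ?M $$ (0, j) * cofactor ?M 0 j)"
    by (rule laplace_expansion_row[OF carrier(2)]) (simp add: m)
  also have "\<dots> = ?M $$ (0, 0) * cofactor ?M 0 0 + ?M $$ (0, Suc k) * cofactor ?M 0 (Suc k)"
    by (rule sum_two_terms) (auto simp: m mat_delete_def cyclic_mat_def)
  also have "?M $$ (0, 0) = u 0"
    by (simp add: m mat_delete_def cyclic_mat_def)
  also have "?M $$ (0, Suc k) = p"
    by (simp add: m mat_delete_def cyclic_mat_def)
  finally have detM: "det ?M = (\<Prod>i<m. u i) + p * (- 1) ^ Suc k *
      continuant (\<lambda>i. d (Suc i)) (\<lambda>i. u (Suc i) * l (Suc i)) (Suc k)"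
    unfolding cofactor_def M1 M0 det_tridiag_mat unfolding m
    by (simp only: prod.lessThan_Suc_shift) (simp add: mult_ac)

  have N1: "mat_delete ?N (Suc k) (Suc k) = tridiag_mat d u l (Suc k)"
    by (rule eq_matI) (auto simp: mat_delete_def tridiag_mat_def cyclic_mat_def m)
  have "det (mat_delete ?N 0 (Suc k)) = (\<Prod>i<Suc k. mat_delete ?N 0 (Suc k) $$ (i, i))"
  proof -
    have "det (mat_delete ?N 0 (Suc k)) = prod_list (diag_mat (mat_delete ?N 0 (Suc k)))"
      by (rule det_upper_triangular[where n = "Suc k"])
        (auto simp: mat_delete_def cyclic_mat_def m)
    thus ?thesis
      by (simp add: prod_list_diag_prod atLeast0LessThan mat_delete_def cyclic_mat_def m)
  qed
  also have "\<dots> = (\<Prod>i<Suc k. l i)"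
    by (rule prod.cong) (auto simp: mat_delete_def cyclic_mat_def m)
  finally have N0: "det (mat_delete ?N 0 (Suc k)) = (\<Prod>i<Suc k. l i)" .
  have "det ?N = (\<Sum>i<m. ?N $$ (i, Suc k) * cofactor ?N i (Suc k))"
    by (rule laplace_expansion_column[OF carrier(3)]) (simp add: m)
  also have "\<dots> = ?N $$ (0, Suc k) * cofactor ?N 0 (Suc k)
      + ?N $$ (Suc k, Suc k) * cofactor ?N (Suc k) (Suc k)"
    by (rule sum_two_terms) (auto simp: m mat_delete_def cyclic_mat_def)
  also have "?N $$ (0, Suc k) = p"
    by (simp add: m mat_delete_def cyclic_mat_def)
  also have "?N $$ (Suc k, Suc k) = u (Suc k)"
    by (simp add: m mat_delete_def cyclic_mat_def)
  finally have detN: "det ?N = p * (- 1) ^ Suc k * (\<Prod>i<Suc k. l i)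
      + u (Suc k) * continuant d (\<lambda>i. u i * l i) (Suc k)"
    unfolding cofactor_def N1 N0 det_tridiag_mat by (simp add: mult_ac flip: mult_2)

  have C1: "mat_delete ?C m m = tridiag_mat d u l m"
    by (rule eq_matI) (auto simp: mat_delete_def tridiag_mat_def cyclic_mat_def m)
  have "det ?C = (\<Sum>j<Suc m. ?C $$ (m, j) * cofactor ?C m j)"
    by (rule laplace_expansion_row[OF carrier(1)]) simp
  also have "\<dots> = (\<Sum>j<m. ?C $$ (m, j) * cofactor ?C m j) + ?C $$ (m, m) * cofactor ?C m m"
    by simp
  also have "(\<Sum>j<m. ?C $$ (m, j) * cofactor ?C m j) =
      ?C $$ (m, 0) * cofactor ?C m 0 + ?C $$ (m, Suc k) * cofactor ?C m (Suc k)"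
    by (rule sum_two_terms) (auto simp: m cyclic_mat_def)
  also have "?C $$ (m, 0) = q"
    by (simp add: m cyclic_mat_def)
  also have "?C $$ (m, Suc k) = l (Suc k)"
    by (simp add: m cyclic_mat_def)
  also have "?C $$ (m, m) = e"
    by (simp add: m cyclic_mat_def)
  finally show ?thesis
    unfolding cofactor_def C1 detM detN det_tridiag_mat
    by (simp add: m algebra_simps power_add flip: mult_2)
qed

section \<open>Interlacing roots of real polynomials\<close>

lemma monic_eq_prod_roots:
  fixes p :: "real poly"
  assumes "degree p = k" "coeff p k = 1" "inj_on y {1..k}" "\<And>j. j \<in> {1..k} \<Longrightarrow> poly p (y j) = 0"
  shows "p = (\<Prod>j=1..k. [:- y j, 1:])"
proof (rule ccontr)
  let ?q = "\<Prod>j=1..k. [:- y j, 1:]"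
  assume "p \<noteq> ?q"
  hence nz: "p - ?q \<noteq> 0" by simp
  have dq: "degree ?q = k"
    by (subst degree_prod_eq_sum_degree) auto
  have "lead_coeff ?q = 1"
    by (simp add: lead_coeff_prod)
  hence cq: "coeff ?q k = 1" using dq by simp
  have "poly ?q (y j) = 0" if "j \<in> {1..k}" for j
    unfolding poly_prod using that by (intro prod_zero) auto
  hence "y ` {1..k} \<subseteq> {x. poly (p - ?q) x = 0}"
    using assms(4) by (intro image_subsetI CollectI) simp
  hence "card (y ` {1..k}) \<le> card {x. poly (p - ?q) x = 0}"
    by (intro card_mono poly_roots_finite nz)
  hence "k \<le> degree (p - ?q)"
    using poly_roots_degree[OF nz] unfolding card_image[OF assms(3)] by simp
  moreover have "degree (p - ?q) \<le> k"
    using assms(1) dq by (intro degree_diff_le) auto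
  ultimately have "degree (p - ?q) = k"
    by simp
  moreover have "coeff (p - ?q) k = 0"
    using assms(2) cq by simp
  ultimately show False using nz by (metis leading_coeff_0_iff)
qed

lemma ex_root_of_sign_change:
  fixes p :: "real poly"
  assumes "a < b" "(- 1) ^ Suc k * poly p a > 0" "(- 1) ^ k * poly p b > 0"
  shows "\<exists>x. a < x \<and> x < b \<and> poly p x = 0"
proof -
  have "poly p a * poly p b < 0"
    using assms(2,3) by (cases "even k") (auto simp: mult_less_0_iff)
  thus ?thesis using poly_IVT[OF assms(1)] by blast
qed

text \<open>
  Reflecting the variable and multiplying by \<open>(- 1) ^ k\<close> turns the claim into one about a monic
  polynomial near \<open>+\<infinity>\<close>.
\<close>

lemma monic_sign_at_left:
  fixes p :: "real poly"
  assumes "degree p = k" "coeff p k = 1"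
  shows "\<exists>x<B. (- 1) ^ k * poly p x > 0"
proof -
  define q where "q = Polynomial.smult ((- 1) ^ k) (pcompose p [:0, - 1:])"
  have "lead_coeff (pcompose p [:0, - 1:]) = (- 1) ^ k"
    by (subst lead_coeff_comp) (simp_all add: assms)
  hence "lead_coeff q = (- 1) ^ k * (- 1) ^ k"
    unfolding q_def lead_coeff_smult by (simp only:)
  hence "lead_coeff q = 1"
    by (simp flip: power_add mult_2)
  then obtain N where N: "\<forall>x\<ge>N. poly q x \<ge> 1"
    using poly_pinfty_gt_lc[of q] by force
  define t where "t = max N (1 - B)"
  have "poly q t \<ge> 1" using N by (simp add: t_def)
  hence "(- 1) ^ k * poly p (- t) > 0" by (simp add: q_def poly_pcompose)
  moreover have "- t < B" by (simp add: t_def)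
  ultimately show ?thesis by blast
qed

lemma strict_mono_on_atLeastAtMost_SucI:
  fixes y :: "nat \<Rightarrow> real"
  assumes "\<And>j. a \<le> j \<Longrightarrow> j < b \<Longrightarrow> y j < y (Suc j)"
  shows "strict_mono_on {a..b} y"
proof (rule strict_mono_onI)
  fix i j assume "i \<in> {a..b}" "j \<in> {a..b}" "i < j"
  from \<open>i < j\<close> have "Suc i \<le> j" by simp
  thus "y i < y j" using \<open>j \<in> {a..b}\<close> \<open>i \<in> {a..b}\<close>
  proof (induction j rule: dec_induct)
    case base
    thus ?case using assms[of i] by auto
  next
    case (step j)
    thus ?case using assms[of j] by force
  qed
qed

text \<open>
  The alternating signs at the points \<open>x j\<close> continue to \<open>-\<infinity>\<close> and \<open>+\<infinity>\<close> because \<open>p\<close> is monic. Each of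
  the resulting \<open>k + 1\<close> gaps therefore contains a root, and the degree leaves room for no others.
  This lemma produces all the interlacing: that of consecutive Jacobi polynomials as well as
  that of the eigenvalues of a periodic Jacobi matrix and of its leading submatrix.
\<close>

lemma interlacing_roots:
  fixes p :: "real poly" and x :: "nat \<Rightarrow> real"
  assumes deg: "degree p = Suc k" and monic: "coeff p (Suc k) = 1"
    and mono: "strict_mono_on {1..k} x"
    and sgn: "\<And>j. j \<in> {1..k} \<Longrightarrow> (- 1) ^ (Suc k - j) * poly p (x j) > 0"
  obtains y where "strict_mono_on {1..Suc k} y" "p = (\<Prod>j=1..Suc k. [:- y j, 1:])"
    "\<And>j. j \<in> {1..k} \<Longrightarrow> y j < x j \<and> x j < y (Suc j)"
proof -
  obtain x0 where x0: "x0 < x 1" "(- 1) ^ Suc k * poly p x0 > 0"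
    using monic_sign_at_left[OF deg monic] by blast
  obtain N where N: "\<forall>t\<ge>N. poly p t \<ge> 1"
    using poly_pinfty_gt_lc[of p] deg monic by auto
  define x1 where "x1 = max N (max (x k) x0 + 1)"
  \<comment> \<open>The points \<open>x j\<close>, extended by points far to the left and far to the right.\<close>
  define X where "X j = (if j = 0 then x0 else if j = Suc k then x1 else x j)" for j
  have sgnX: "(- 1) ^ (Suc k - j) * poly p (X j) > 0" if "j \<le> Suc k" for j
  proof -
    have "poly p x1 > 0" using N[rule_format, of x1] by (simp add: x1_def)
    thus ?thesis using that x0 sgn[of j] by (auto simp: X_def)
  qed
  have stepX: "X j < X (Suc j)" if "j \<le> k" for j
  proof -
    consider "j = 0" "k = 0" | "j = 0" "k > 0" | "j > 0" "j = k" | "j > 0" "j < k"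
      using \<open>j \<le> k\<close> by linarith
    thus ?thesis
    proof cases
      case 4
      thus ?thesis using strict_mono_onD[OF mono, of j "Suc j"] by (simp add: X_def)
    qed (use x0 in \<open>auto simp: X_def x1_def\<close>)
  qed
  have "\<exists>t. X j < t \<and> t < X (Suc j) \<and> poly p t = 0" if "j \<le> k" for j
  proof (rule ex_root_of_sign_change[OF stepX[OF that], where k = "k - j"])
    show "(- 1) ^ Suc (k - j) * poly p (X j) > 0"
      using sgnX[of j] that by (simp add: Suc_diff_le)
    show "(- 1) ^ (k - j) * poly p (X (Suc j)) > 0"
      using sgnX[of "Suc j"] that by simp
  qed
  then obtain r where r: "\<And>j. j \<le> k \<Longrightarrow> X j < r j \<and> r j < X (Suc j) \<and> poly p (r j) = 0"
    by metis
  \<comment> \<open>\<open>r j\<close> lies to the right of \<open>X j\<close>; the index shift makes the roots start at 1.\<close>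
  define y where "y j = r (j - 1)" for j
  have y: "X (j - 1) < y j \<and> y j < X j \<and> poly p (y j) = 0" if "j \<in> {1..Suc k}" for j
    using r[of "j - 1"] that by (auto simp: y_def)
  have il: "y j < x j \<and> x j < y (Suc j)" if "j \<in> {1..k}" for j
    using y[of j] y[of "Suc j"] that by (auto simp: X_def)
  have ymono: "strict_mono_on {1..Suc k} y"
  proof (rule strict_mono_on_atLeastAtMost_SucI)
    fix j assume "1 \<le> j" "j < Suc k"
    thus "y j < y (Suc j)" using il[of j] by auto
  qed
  show thesis
  proof (rule that[OF ymono monic_eq_prod_roots il])
    show "inj_on y {1..Suc k}"
      using ymono by (rule strict_mono_on_imp_inj_on)
  qed (use deg monic y in auto)
qed

lemma sign_prod_between_roots:
  fixes x :: "nat \<Rightarrow> real"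
  assumes "j \<in> {1..Suc k}" "\<And>i. i \<in> {1..<j} \<Longrightarrow> x i < t" "\<And>i. i \<in> {j..k} \<Longrightarrow> t < x i"
  shows "(- 1) ^ (Suc k - j) * poly (\<Prod>i=1..k. [:- x i, 1:]) t > 0"
proof -
  have "{1..k} = {1..<j} \<union> {j..k}" using assms(1) by auto
  hence "poly (\<Prod>i=1..k. [:- x i, 1:]) t = (\<Prod>i\<in>{1..<j}. t - x i) * (\<Prod>i\<in>{j..k}. t - x i)"
    by (simp add: poly_prod) (subst prod.union_disjoint, auto)
  also have "(\<Prod>i\<in>{j..k}. t - x i) = (\<Prod>i\<in>{j..k}. (- 1) * (x i - t))"
    by simp
  also have "\<dots> = (- 1) ^ (Suc k - j) * (\<Prod>i\<in>{j..k}. x i - t)"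
    by (subst prod.distrib) simp
  finally have "(- 1) ^ (Suc k - j) * poly (\<Prod>i=1..k. [:- x i, 1:]) t =
      (\<Prod>i\<in>{1..<j}. t - x i) * (\<Prod>i\<in>{j..k}. x i - t)"
    by (simp flip: power_mult_distrib)
  thus ?thesis
    using assms(2,3) by (auto intro!: mult_pos_pos prod_pos)
qed

section \<open>Jacobi polynomials\<close>

text \<open>
  The characteristic polynomial of the Jacobi matrix with diagonal \<open>c\<close> whose off-diagonal entries
  have squared moduli \<open>w\<close>; only these moduli matter, so the polynomial is real even if the
  entries are not.
\<close>

abbreviation jacobi_poly :: "(nat \<Rightarrow> real) \<Rightarrow> (nat \<Rightarrow> real) \<Rightarrow> nat \<Rightarrow> real poly" where
  "jacobi_poly c w \<equiv> continuant (\<lambda>i. [:- c i, 1:]) (\<lambda>i. [:w i:])"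

lemma jacobi_poly_monic:
  "degree (jacobi_poly c w k) = k \<and> coeff (jacobi_poly c w k) k = 1"
proof (induction k rule: induct_nat_012)
  case (ge2 k)
  let ?P = "jacobi_poly c w"
  have "degree ([:- c (Suc k), 1:] * ?P (Suc k)) = Suc (Suc k)"
    using ge2 by (subst degree_mult_eq) auto
  moreover have "degree ([:w k:] * ?P k) < Suc (Suc k)"
    using ge2 degree_smult_le[of "w k" "?P k"] by simp
  ultimately have "degree (?P (Suc (Suc k))) = Suc (Suc k)"
    by (simp only: continuant.simps) (subst diff_conv_add_uminus, subst degree_add_eq_left, simp_all)
  moreover have "coeff (?P (Suc (Suc k))) (Suc (Suc k)) = 1"
    using ge2 by (simp add: coeff_eq_0)
  ultimately show ?case by blast
qed auto

text \<open>
  Sturm's argument. At a root of the polynomial of degree \<open>k + 1\<close> the recurrence says that its two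
  neighbours have opposite signs. So the alternating signs of one neighbour at these roots, which
  the induction hypothesis records, pass to the other one and make its roots interlace them. The
  interlacing then gives the sign pattern needed for the next step.
\<close>

lemma jacobi_poly_real_rooted:
  assumes "\<And>i. i < k \<Longrightarrow> w i > 0"
  shows "\<exists>x. strict_mono_on {1..Suc k} x \<and> jacobi_poly c w (Suc k) = (\<Prod>j=1..Suc k. [:- x j, 1:]) \<and>
    (\<forall>j\<in>{1..Suc k}. (- 1) ^ (Suc k - j) * poly (jacobi_poly c w k) (x j) > 0)"
  using assms
proof (induction k)
  case 0
  show ?case by (intro exI[of _ "\<lambda>_. c 0"]) (auto simp: strict_mono_on_def)
next
  case (Suc k)
  let ?P = "jacobi_poly c w"
  from Suc.IH Suc.prems obtain x where x: "strict_mono_on {1..Suc k} x"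
    "?P (Suc k) = (\<Prod>j=1..Suc k. [:- x j, 1:])"
    "\<And>j. j \<in> {1..Suc k} \<Longrightarrow> (- 1) ^ (Suc k - j) * poly (?P k) (x j) > 0"
    by (meson less_SucI)
  have root: "poly (?P (Suc k)) (x j) = 0" if "j \<in> {1..Suc k}" for j
    unfolding x(2) poly_prod using that by (intro prod_zero) auto
  \<comment> \<open>At a root of \<open>?P (Suc k)\<close> the recurrence reads \<open>?P (Suc (Suc k)) = - w k * ?P k\<close>.\<close>
  have sgn: "(- 1) ^ (Suc (Suc k) - j) * poly (?P (Suc (Suc k))) (x j) > 0"
    if j: "j \<in> {1..Suc k}" for j
  proof -
    have "(- 1) ^ (Suc (Suc k) - j) * poly (?P (Suc (Suc k))) (x j) =
        w k * ((- 1) ^ (Suc k - j) * poly (?P k) (x j))"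
      using root[OF j] j by (simp add: Suc_diff_le)
    thus ?thesis using x(3)[OF j] Suc.prems[of k] by simp
  qed
  obtain y where y: "strict_mono_on {1..Suc (Suc k)} y"
    "?P (Suc (Suc k)) = (\<Prod>j=1..Suc (Suc k). [:- y j, 1:])"
    "\<And>j. j \<in> {1..Suc k} \<Longrightarrow> y j < x j \<and> x j < y (Suc j)"
    using interlacing_roots[OF _ _ x(1) sgn] jacobi_poly_monic by blast
  have "(- 1) ^ (Suc (Suc k) - j) * poly (?P (Suc k)) (y j) > 0" if j: "j \<in> {1..Suc (Suc k)}" for j
    unfolding x(2)
  proof (rule sign_prod_between_roots[OF j])
    fix i assume i: "i \<in> {1..<j}"
    hence "x i < y (Suc i)" using y(3)[of i] j by auto
    also have "y (Suc i) \<le> y j"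
      using i j by (intro strict_mono_on_leD[OF y(1)]) auto
    finally show "x i < y j" .
  next
    fix i assume i: "i \<in> {j..Suc k}"
    hence "y j \<le> y i"
      using j by (intro strict_mono_on_leD[OF y(1)]) auto
    also have "y i < x i" using y(3)[of i] i j by auto
    finally show "y j < x i" .
  qed
  thus ?case using y(1,2) by blast
qed

lemma map_poly_of_real_jacobi_poly:
  "map_poly complex_of_real (jacobi_poly c w k) =
    continuant (\<lambda>i. [:- complex_of_real (c i), 1:]) (\<lambda>i. [:complex_of_real (w i):]) k"
proof -
  interpret h: map_poly_inj_idom_hom "of_real :: real \<Rightarrow> complex" ..
  show ?thesis by (simp add: h.hom_continuant of_real_hom.map_poly_pCons_hom)
qed

text \<open>
  If \<open>A\<close> and \<open>B\<close> have the same sign, then by the inequality between the arithmetic and the geometric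
  mean \<open>\<bar>A + B\<bar>\<close> is at least twice the square root of \<open>A * B\<close>, so adding \<open>2 * r\<close> cannot change the
  sign of \<open>A + B\<close>.
\<close>

lemma same_sign_add_of_square_less_prod:
  fixes A B r :: real
  assumes "r\<^sup>2 < A * B"
  shows "A * (A + B + 2 * r) > 0"
proof -
  have "0 \<le> (A + r)\<^sup>2" by simp
  also have "\<dots> < A * (A + B + 2 * r)"
    using assms by (simp add: power2_eq_square algebra_simps)
  finally show ?thesis .
qed

text \<open>
  At a root of the degree-\<open>m\<close> polynomial, \<open>continuant_identity\<close> shows that the two terms
  containing Jacobi polynomials of degree \<open>m - 1\<close> have product \<open>\<Prod>i<Suc m. w i\<close>. The summand \<open>2 * r\<close>
  is too small to change the sign of their sum. Later \<open>r\<close> is the real part of the product \<open>\<beta>\<close> of the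
  off-diagonal entries and the product of the \<open>w i\<close> is its squared modulus, so the hypothesis on
  \<open>r\<close> means exactly that \<open>\<beta>\<close> is nonreal.
\<close>

lemma root_discriminant_same_sign:
  fixes c w :: "nat \<Rightarrow> real"
  assumes m: "m \<ge> 2" and w: "w (m - 1) > 0"
    and root: "poly (jacobi_poly c w m) x = 0"
    and r: "r\<^sup>2 < (\<Prod>i<Suc m. w i)"
  shows "poly (jacobi_poly c w (m - 1)) x *
    poly ([:w (m - 1):] * jacobi_poly c w (m - 1)
      + [:w m:] * jacobi_poly (\<lambda>i. c (Suc i)) (\<lambda>i. w (Suc i)) (m - 1) + [:2 * r:]) x > 0"
proof -
  obtain k where k: "m = Suc (Suc k)"
    using m by (metis add_2_eq_Suc le_Suc_ex)
  define p where "p = poly (jacobi_poly c w (m - 1)) x"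
  define s where "s = poly (jacobi_poly (\<lambda>i. c (Suc i)) (\<lambda>i. w (Suc i)) (m - 1)) x"
  have "p * s = poly (\<Prod>i\<le>k. [:w i:]) x"
    using arg_cong[OF continuant_identity[of "\<lambda>i. [:- c i, 1:]" "\<lambda>i. [:w i:]" k], of "\<lambda>p. poly p x"]
      root by (simp add: p_def s_def k del: continuant.simps)
  hence prod: "(w (m - 1) * p) * (w m * s) = (\<Prod>i<Suc m. w i)"
    by (simp add: k poly_prod lessThan_Suc_atMost mult_ac)
  have "w (m - 1) * p * (w (m - 1) * p + w m * s + 2 * r) > 0"
    by (rule same_sign_add_of_square_less_prod) (unfold prod, rule r)
  hence "p * (w (m - 1) * p + w m * s + 2 * r) > 0"
    using w by (simp add: mult.assoc zero_less_mult_iff)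
  thus ?thesis by (simp add: p_def s_def)
qed

section \<open>Eigenvalues\<close>

lemma order_prod_distinct_linear:
  fixes p :: "'a :: idom poly"
  assumes "finite I" "inj_on e I" "i \<in> I"
  shows "Polynomial.order (e i) (\<Prod>j\<in>I. [:- e j, 1:]) = 1"
proof -
  let ?q = "\<Prod>j\<in>I - {i}. [:- e j, 1:]"
  have split: "(\<Prod>j\<in>I. [:- e j, 1:]) = [:- e i, 1:] * ?q"
    by (rule prod.remove[OF assms(1,3)])
  have "poly ?q (e i) \<noteq> 0"
    using assms by (auto simp: poly_prod inj_on_def)
  hence "Polynomial.order (e i) ?q = 0" by (rule order_0I)
  moreover have "[:- e i, 1:] * ?q \<noteq> 0"
    using assms(1) by (subst mult_eq_0_iff) auto
  moreover have "Polynomial.order (e i) [:- e i, 1:] = 1"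
    using order_power_n_n[of "e i" 1] by simp
  ultimately show ?thesis unfolding split by (subst order_mult) auto
qed

lemma real_simple_eigenvaluesI:
  assumes A: "A \<in> carrier_mat m m" and mono: "strict_mono_on {1..m} e"
    and p: "char_poly A = map_poly of_real (\<Prod>k=1..m. [:- e k, 1:])"
  shows "real_simple_eigenvalues A m e"
proof -
  have p': "char_poly A = (\<Prod>k=1..m. [:- complex_of_real (e k), 1:])"
  proof -
    interpret h: map_poly_inj_idom_hom "of_real :: real \<Rightarrow> complex" ..
    show ?thesis unfolding p by (simp add: h.hom_prod h.map_poly_pCons_hom)
  qed
  have "inj_on (\<lambda>k. complex_of_real (e k)) {1..m}"
    using strict_mono_on_imp_inj_on[OF mono] unfolding inj_on_def of_real_eq_iff .
  hence "Polynomial.order (complex_of_real (e k)) (char_poly A) = 1" if "k \<in> {1..m}" for k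
    unfolding p' using order_prod_distinct_linear[of "{1..m}" "\<lambda>k. complex_of_real (e k)"] that by simp
  moreover have "spectrum A = (\<lambda>k. complex_of_real (e k)) ` {1..m}"
    unfolding spectrum_def eigenvalue_root_char_poly[OF A] p' poly_prod
    by (simp add: image_def)
  ultimately show ?thesis
    unfolding real_simple_eigenvalues_def using mono by blast
qed

text \<open>
  For an eigenvector \<open>v\<close> of a matrix that is Hermitian except for its last diagonal entry, the
  imaginary part of the quadratic form \<open>\<Sum>i. cnj (v $ i) * (A *\<^sub>v v) $ i\<close> is
  \<open>Im z * (\<Sum>i. (cmod (v $ i))\<^sup>2) = Im (A $$ (m, m)) * (cmod (v $ m))\<^sup>2\<close>. The last coordinate of
  \<open>v\<close> is nonzero, since otherwise deleting it would leave an eigenvector of the leading submatrix for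
  the same eigenvalue, contrary to the assumption \<open>sub\<close>.
\<close>

lemma sgn_Im_eigenvalue:
  fixes A :: "complex mat"
  assumes A: "A \<in> carrier_mat (Suc m) (Suc m)"
    and herm: "\<And>i j. i \<le> m \<Longrightarrow> j \<le> m \<Longrightarrow> (i, j) \<noteq> (m, m) \<Longrightarrow> A $$ (j, i) = cnj (A $$ (i, j))"
    and ev: "eigenvalue A z"
    and sub: "\<not> eigenvalue (mat m m (\<lambda>(i, j). A $$ (i, j))) z"
  shows "sgn (Im z) = sgn (Im (A $$ (m, m)))"
proof -
  let ?B = "mat m m (\<lambda>(i, j). A $$ (i, j))"
  from ev A obtain v where v: "v \<in> carrier_vec (Suc m)" "v \<noteq> 0\<^sub>v (Suc m)" "A *\<^sub>v v = z \<cdot>\<^sub>v v"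
    by (auto simp: eigenvalue_def eigenvector_def)
  have row: "(\<Sum>j<Suc m. A $$ (i, j) * v $ j) = z * v $ i" if "i < Suc m" for i
  proof -
    have "(A *\<^sub>v v) $ i = (\<Sum>j<Suc m. A $$ (i, j) * v $ j)"
      using A v(1) that by (simp add: scalar_prod_def atLeast0LessThan)
    thus ?thesis using v that by simp
  qed
  have last: "v $ m \<noteq> 0"
  proof
    assume last: "v $ m = 0"
    define v' where "v' = vec m (\<lambda>i. v $ i)"
    have "v' \<noteq> 0\<^sub>v m"
    proof
      assume "v' = 0\<^sub>v m"
      hence "v $ i = 0" if "i < m" for i
        using that by (auto simp: v'_def vec_eq_iff)
      hence "v = 0\<^sub>v (Suc m)"
        using v(1) last by (auto simp: less_Suc_eq intro!: eq_vecI)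
      thus False using v(2) by simp
    qed
    moreover have "?B *\<^sub>v v' = z \<cdot>\<^sub>v v'"
    proof (rule eq_vecI)
      fix i assume "i < dim_vec (z \<cdot>\<^sub>v v')"
      thus "(?B *\<^sub>v v') $ i = (z \<cdot>\<^sub>v v') $ i"
        using row[of i] last by (simp add: v'_def scalar_prod_def atLeast0LessThan)
    qed (simp add: v'_def)
    moreover have "v' \<in> carrier_vec m" by (simp add: v'_def)
    ultimately have "eigenvalue ?B z"
      unfolding eigenvalue_def eigenvector_def by auto
    thus False using sub by simp
  qed
  let ?N = "\<Sum>i<Suc m. (cmod (v $ i))\<^sup>2"
  let ?S = "\<Sum>i<Suc m. \<Sum>j<Suc m. cnj (v $ i) * A $$ (i, j) * v $ j"
  have "?S = (\<Sum>i<Suc m. cnj (v $ i) * (z * v $ i))"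
    by (rule sum.cong) (simp_all add: mult.assoc flip: sum_distrib_left row)
  also have "\<dots> = z * of_real ?N"
    by (simp only: of_real_sum sum_distrib_left complex_norm_square mult_ac)
  finally have S: "?S = z * of_real ?N" .
  have "cnj ?S = (\<Sum>i<Suc m. \<Sum>j<Suc m. v $ i * cnj (A $$ (i, j)) * cnj (v $ j))"
    by simp
  also have "\<dots> = (\<Sum>i<Suc m. \<Sum>j<Suc m. v $ j * cnj (A $$ (j, i)) * cnj (v $ i))"
    by (rule sum.swap)
  finally have "?S - cnj ?S =
      (\<Sum>i<Suc m. \<Sum>j<Suc m. cnj (v $ i) * (A $$ (i, j) - cnj (A $$ (j, i))) * v $ j)"
    by (simp only: sum_subtractf [symmetric] algebra_simps)
  also have "\<dots> = (\<Sum>i<Suc m. \<Sum>j<Suc m. if i = m \<and> j = m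
      then cnj (v $ m) * (A $$ (m, m) - cnj (A $$ (m, m))) * v $ m else 0)"
    by (intro sum.cong refl) (use herm in \<open>auto simp: less_Suc_eq_le\<close>)
  also have "\<dots> = cnj (v $ m) * (A $$ (m, m) - cnj (A $$ (m, m))) * v $ m"
    by simp
  also have "\<dots> = (A $$ (m, m) - cnj (A $$ (m, m))) * of_real ((cmod (v $ m))\<^sup>2)"
    by (simp only: complex_norm_square mult_ac)
  finally have "Im z * ?N = Im (A $$ (m, m)) * (cmod (v $ m))\<^sup>2"
    unfolding S complex_diff_cnj by (simp add: complex_eq_iff)
  moreover have "?N > 0"
    using last by (intro sum_pos2[of _ m]) auto
  ultimately show ?thesis
    using last by (metis mult.right_neutral sgn_mult sgn_pos zero_less_norm_iff zero_less_power)
qed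

section \<open>Periodic Jacobi matrices\<close>

lemma submatrix_leading_principal:
  assumes "A \<in> carrier_mat n n" "m \<le> n"
  shows "submatrix A {0..<m} {0..<m} = mat m m (\<lambda>(i, j). A $$ (i, j))"
proof -
  have pick: "pick {0..<m} i = i" if "i < m" for i
  proof -
    have "{a \<in> {0..<m}. a < i} = {0..<i}" using that by auto
    thus ?thesis using pick_card_in_set[of i "{0..<m}"] that by simp
  qed
  have "{i. i < n \<and> i \<in> {0..<m}} = {0..<m}" using assms(2) by auto
  thus ?thesis
    using assms(1) unfolding submatrix_def by (intro eq_matI) (auto simp: pick)
qed

lemma prod_const_poly:
  fixes m :: nat
  shows "(\<Prod>i<m. [:f i:]) = [:\<Prod>i<m. f i :: 'a :: comm_ring_1:]"
  by (induction m) (simp_all add: one_pCons mult.commute)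

lemma char_poly_leading_jacobi:
  "char_poly (mat m m (\<lambda>(i, j). periodic_jacobi_mat (Suc m) c b a $$ (i, j))) =
    map_poly of_real (jacobi_poly (\<lambda>i. c (Suc i)) (\<lambda>i. (cmod (b (Suc i)))\<^sup>2) m)"
proof -
  let ?A = "mat m m (\<lambda>(i, j). periodic_jacobi_mat (Suc m) c b a $$ (i, j))"
  have "char_poly_matrix ?A = tridiag_mat (\<lambda>i. [:- complex_of_real (c (Suc i)), 1:])
      (\<lambda>i. [:- b (Suc i):]) (\<lambda>i. [:- cnj (b (Suc i)):]) m"
    by (rule eq_matI) (auto simp: char_poly_matrix_def tridiag_mat_def periodic_jacobi_mat_def)
  thus ?thesis
    unfolding char_poly_def map_poly_of_real_jacobi_poly complex_norm_square
    by (simp add: det_tridiag_mat mult.commute)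
qed

text \<open>
  The three continuants of \<open>det_cyclic_mat\<close> carry the factors \<open>\<lambda> - a\<close> and the squared moduli of
  the last two off-diagonal entries. The two full cycles contribute \<open>\<beta>\<close> and its conjugate, where
  \<open>\<beta> = b 1 * \<dots> * b (Suc m)\<close>, and all signs combine to \<open>- 2 * Re \<beta>\<close>. Hence everything except \<open>a\<close>
  enters through real polynomials.
\<close>

lemma char_poly_periodic_jacobi:
  fixes c b m
  defines "w \<equiv> \<lambda>i. (cmod (b (Suc i)))\<^sup>2"
  assumes "m \<ge> 2"
  shows "char_poly (periodic_jacobi_mat (Suc m) c b a) =
    [:- a, 1:] * map_poly of_real (jacobi_poly (\<lambda>i. c (Suc i)) w m)
    - map_poly of_real
       ([:w (m - 1):] * jacobi_poly (\<lambda>i. c (Suc i)) w (m - 1)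
        + [:w m:] * jacobi_poly (\<lambda>i. c (Suc (Suc i))) (\<lambda>i. w (Suc i)) (m - 1)
        + [:2 * Re (\<Prod>k=1..Suc m. b k):])"
proof -
  let ?J = "periodic_jacobi_mat (Suc m) c b a"
  define d where "d = (\<lambda>i. [:- complex_of_real (c (Suc i)), 1:])"
  define u where "u = (\<lambda>i. [:- b (Suc i):])"
  define l where "l = (\<lambda>i. [:- cnj (b (Suc i)):])"
  have ul: "u i * l i = [:complex_of_real (w i):]" for i
    unfolding u_def l_def w_def complex_norm_square by simp
  have lu: "l i * u i = [:complex_of_real (w i):]" for i
    using ul[of i] by (simp add: mult.commute)
  have mat: "char_poly_matrix ?J = cyclic_mat d [:- a, 1:] u l (l m) (u m) m"
    using assms(2)
    by (intro eq_matI)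
      (auto simp: char_poly_matrix_def cyclic_mat_def periodic_jacobi_mat_def d_def u_def l_def)
  define \<beta> where "\<beta> = (\<Prod>k=1..Suc m. b k)"
  have \<beta>: "\<beta> = (\<Prod>i<Suc m. b (Suc i))"
    unfolding \<beta>_def by (simp add: prod.atLeast1_atMost_eq)
  have "u m * (\<Prod>i<m. u i) = (\<Prod>i<Suc m. u i)"
    by (simp add: mult.commute)
  also have "\<dots> = [:(- 1) ^ Suc m * \<beta>:]"
    unfolding u_def prod_const_poly prod_uminus \<beta> by simp
  finally have u: "u m * (\<Prod>i<m. u i) = [:(- 1) ^ Suc m * \<beta>:]" .
  have "l m * (\<Prod>i<m. l i) = (\<Prod>i<Suc m. l i)"
    by (simp add: mult.commute)
  also have "\<dots> = [:(- 1) ^ Suc m * cnj \<beta>:]"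
    unfolding l_def prod_const_poly prod_uminus \<beta> by simp
  finally have l: "l m * (\<Prod>i<m. l i) = [:(- 1) ^ Suc m * cnj \<beta>:]" .
  have corner: "(- 1) ^ m * (u m * (\<Prod>i<m. u i) + l m * (\<Prod>i<m. l i)) =
      - [:complex_of_real (2 * Re \<beta>):]"
    unfolding u l by (cases "even m") (simp_all add: complex_eq_iff)
  interpret h: map_poly_inj_idom_hom "of_real :: real \<Rightarrow> complex" ..
  have "char_poly ?J = [:- a, 1:] * continuant d (\<lambda>i. [:complex_of_real (w i):]) m
      - [:complex_of_real (w (m - 1)):] * continuant d (\<lambda>i. [:complex_of_real (w i):]) (m - 1)
      - [:complex_of_real (w m):] * continuant (\<lambda>i. d (Suc i)) (\<lambda>i. [:complex_of_real (w (Suc i)):]) (m - 1)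
      - [:complex_of_real (2 * Re \<beta>):]"
    unfolding char_poly_def mat det_cyclic_mat[OF assms(2)] corner ul lu by simp
  thus ?thesis
    unfolding h.hom_add h.hom_mult map_poly_of_real_jacobi_poly \<beta>_def[symmetric]
    by (simp add: d_def of_real_hom.map_poly_pCons_hom)
qed

theorem theorem3p1:
  fixes n :: nat and c :: "nat \<Rightarrow> real" and b :: "nat \<Rightarrow> complex" and a :: complex
    and J J' :: "complex mat"
  assumes "n \<ge> 3"
    and "\<And>k. k \<in> {1..n} \<Longrightarrow> b k \<noteq> 0"
    and "J = periodic_jacobi_mat n c b a"
    and "J' = submatrix J {0..<n - 1} {0..<n - 1}"
    and "(\<Prod>k=1..n. b k) \<notin> \<real>"
  shows "\<exists>\<mu> :: nat \<Rightarrow> real.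
    real_simple_eigenvalues J' (n - 1) \<mu> \<and>
    (a \<in> \<real> \<longrightarrow>
      (\<exists>l :: nat \<Rightarrow> real. real_simple_eigenvalues J n l \<and>
         (\<forall>k\<in>{1..n - 1}. l k < \<mu> k \<and> \<mu> k < l (k + 1)))) \<and>
    (Im a > 0 \<longrightarrow> (\<forall>z. eigenvalue J z \<longrightarrow> Im z > 0)) \<and>
    (Im a < 0 \<longrightarrow> (\<forall>z. eigenvalue J z \<longrightarrow> Im z < 0)) \<and>
    (\<forall>k\<in>{1..n - 1}.
       poly (char_poly J) (complex_of_real (\<mu> k)) \<in> \<real> \<and>
       (- 1) ^ (n - k) * Re (poly (char_poly J) (complex_of_real (\<mu> k))) > 0)"
proof -
  define m where "m = n - 1"
  have n: "n = Suc m" and m: "m \<ge> 2" using assms(1) by (auto simp: m_def)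
  define w where "w = (\<lambda>i. (cmod (b (Suc i)))\<^sup>2)"
  define \<beta> where "\<beta> = (\<Prod>k=1..Suc m. b k)"
  define P where "P = jacobi_poly (\<lambda>i. c (Suc i)) w"
  define R where "R = [:w (m - 1):] * P (m - 1)
    + [:w m:] * jacobi_poly (\<lambda>i. c (Suc (Suc i))) (\<lambda>i. w (Suc i)) (m - 1) + [:2 * Re \<beta>:]"
  have w: "w i > 0" if "i < Suc m" for i
    using assms(2)[of "Suc i"] that by (simp add: w_def n)
  have J: "J \<in> carrier_mat (Suc m) (Suc m)"
    by (simp add: assms(3) n periodic_jacobi_mat_def)
  have J': "J' = mat m m (\<lambda>(i, j). J $$ (i, j))"
    unfolding assms(4) n by (simp add: submatrix_leading_principal[OF J])
  have cpJ': "char_poly J' = map_poly of_real (P m)"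
    unfolding J' assms(3) n P_def w_def by (rule char_poly_leading_jacobi)
  have cpJ: "char_poly J = [:- a, 1:] * map_poly of_real (P m) - map_poly of_real R"
    unfolding assms(3) n P_def w_def R_def \<beta>_def by (rule char_poly_periodic_jacobi[OF m])

  have "\<exists>x. strict_mono_on {1..Suc (m - 1)} x \<and> P (Suc (m - 1)) = (\<Prod>j=1..Suc (m - 1). [:- x j, 1:]) \<and>
      (\<forall>j\<in>{1..Suc (m - 1)}. (- 1) ^ (Suc (m - 1) - j) * poly (P (m - 1)) (x j) > 0)"
    unfolding P_def by (rule jacobi_poly_real_rooted) (use w in auto)
  moreover have "Suc (m - 1) = m" using m by simp
  ultimately obtain \<mu> where \<mu>: "strict_mono_on {1..m} \<mu>" "P m = (\<Prod>j=1..m. [:- \<mu> j, 1:])"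
    "\<And>j. j \<in> {1..m} \<Longrightarrow> (- 1) ^ (m - j) * poly (P (m - 1)) (\<mu> j) > 0"
    by auto
  have root: "poly (P m) (\<mu> j) = 0" if "j \<in> {1..m}" for j
    unfolding \<mu>(2) poly_prod using that by (intro prod_zero) auto
  have simple: "real_simple_eigenvalues J' m \<mu>"
    by (rule real_simple_eigenvaluesI) (use \<mu> cpJ' in \<open>auto simp: J'\<close>)

  \<comment> \<open>This strict inequality is where the nonreality of \<open>\<beta>\<close> enters.\<close>
  have "(Re \<beta>)\<^sup>2 < (cmod \<beta>)\<^sup>2"
    using assms(5) by (simp add: \<beta>_def n cmod_power2 complex_is_Real_iff)
  also have "(cmod \<beta>)\<^sup>2 = (\<Prod>i<Suc m. w i)"
    by (simp add: \<beta>_def w_def prod.atLeast1_atMost_eq norm_mult prod_norm power_mult_distrib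
        flip: prod_power_distrib)
  finally have \<beta>: "(Re \<beta>)\<^sup>2 < (\<Prod>i<Suc m. w i)" .
  \<comment> \<open>At a root of \<open>P m\<close> the value of the characteristic polynomial of \<open>J\<close> is \<open>- R\<close>, whatever \<open>a\<close> is, so
    the sign of \<open>R\<close> there settles the third claim.\<close>
  have signR: "(- 1) ^ (m - j) * poly R (\<mu> j) > 0" if "j \<in> {1..m}" for j
  proof -
    have "poly (P (m - 1)) (\<mu> j) * poly R (\<mu> j) > 0"
      unfolding P_def R_def
      by (rule root_discriminant_same_sign[OF m _ _ \<beta>]) (use w root[OF that] in \<open>auto simp: P_def\<close>)
    thus ?thesis
      using \<mu>(3)[OF that] by (cases "even (m - j)") (auto simp: zero_less_mult_iff)
  qed
  have chi: "poly (char_poly J) (of_real (\<mu> j)) = of_real (- poly R (\<mu> j))" if "j \<in> {1..m}" for j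
    unfolding cpJ using root[OF that] by simp
  have part3: "poly (char_poly J) (of_real (\<mu> j)) \<in> \<real> \<and>
      (- 1) ^ (n - j) * Re (poly (char_poly J) (of_real (\<mu> j))) > 0" if "j \<in> {1..m}" for j
    unfolding chi[OF that] using signR[OF that] that by (simp add: n Suc_diff_le)

  have part1: "\<exists>l. real_simple_eigenvalues J n l \<and> (\<forall>k\<in>{1..m}. l k < \<mu> k \<and> \<mu> k < l (k + 1))"
    if "a \<in> \<real>"
  proof -
    define p where "p = [:- Re a, 1:] * P m - R"
    interpret h: map_poly_inj_idom_hom "of_real :: real \<Rightarrow> complex" ..
    have cp: "char_poly J = map_poly of_real p"
      using that unfolding cpJ p_def h.hom_minus h.hom_mult
      by (simp add: of_real_hom.map_poly_pCons_hom)
    have "degree p = Suc m" "coeff p (Suc m) = 1"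
      using degree_monic_char_poly[OF J] by (auto simp: cp)
    moreover have "(- 1) ^ (Suc m - j) * poly p (\<mu> j) > 0" if "j \<in> {1..m}" for j
      using signR[OF that] root[OF that] that by (simp add: p_def Suc_diff_le)
    ultimately obtain l where l: "strict_mono_on {1..Suc m} l" "p = (\<Prod>j=1..Suc m. [:- l j, 1:])"
      "\<And>j. j \<in> {1..m} \<Longrightarrow> l j < \<mu> j \<and> \<mu> j < l (Suc j)"
      using interlacing_roots[OF _ _ \<mu>(1)] by blast
    have "real_simple_eigenvalues J n l"
      unfolding n by (rule real_simple_eigenvaluesI[OF J l(1)]) (simp only: cp l(2))
    thus ?thesis using l(3) by auto
  qed

  \<comment> \<open>No eigenvalue of \<open>J\<close> is one of the \<open>\<mu> j\<close>, since the characteristic polynomial of \<open>J\<close> does not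
    vanish there.\<close>
  have part2: "sgn (Im z) = sgn (Im a)" if z: "eigenvalue J z" for z
  proof -
    have "\<not> eigenvalue J' z"
    proof
      assume "eigenvalue J' z"
      hence "z \<in> spectrum J'" by (simp add: spectrum_def)
      then obtain j where j: "j \<in> {1..m}" "z = of_real (\<mu> j)"
        using simple unfolding real_simple_eigenvalues_def by auto
      have "poly (char_poly J) z = 0"
        using z eigenvalue_root_char_poly[OF J] by simp
      thus False using part3[OF j(1)] j(2) by simp
    qed
    moreover have "J $$ (j, i) = cnj (J $$ (i, j))" if "i \<le> m" "j \<le> m" "(i, j) \<noteq> (m, m)" for i j
      using that m by (auto simp: assms(3) n periodic_jacobi_mat_def)
    ultimately have "sgn (Im z) = sgn (Im (J $$ (m, m)))"
      using sgn_Im_eigenvalue[OF J _ z] unfolding J' by blast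
    thus ?thesis by (simp add: assms(3) n periodic_jacobi_mat_def)
  qed
  have "Im z > 0" if "Im a > 0" "eigenvalue J z" for z
    using part2[OF that(2)] that(1) by (simp add: sgn_1_pos)
  moreover have "Im z < 0" if "Im a < 0" "eigenvalue J z" for z
    using part2[OF that(2)] that(1) by (simp add: sgn_1_neg)
  ultimately show ?thesis
    using simple part1 part3 unfolding m_def by blast
qed

end
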